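(* Let $\kappa$ be an infinite cardinal and assume that the weak diamond $\Phi_{\kappa^+}$ holds. Then there exists a cardinal $\lambda\leq 2^{\kappa^+}$ such that every collection of $\lambda$ closed unbounded subsets of $\kappa^+$ contains a subfamily of size $\kappa^+$ whose intersection contains a closed unbounded subset of $\kappa^+$.
   Context: The weak diamond on $\kappa^+$, denoted $\Phi_{\kappa^+}$, is the following principle: for every function $F:{}^{<\kappa^+}2\rightarrow 2$ there exists a function $g\in{}^{\kappa^+}2$ such that for every $f\in{}^{\kappa^+}2$ the set $\{\alpha\in\kappa^+: F(f\upharpoonright\alpha)=g(\alpha)\}$ is a stationary subset of $\kappa^+$. Here ${}^{<\kappa^+}2=\bigcup_{\alpha<\kappa^+}{}^\alpha 2$. Collections are indexed families $\{C_\alpha:\alpha<\lambda\}$, and the size of a subfamily is the cardinality of its set of indices. *)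

theory Defs
  imports Main
begin

unbundle cardinal_syntax

text \<open>
  Ordinals are represented by well-orders: for a well-order \<open>r\<close>, the ordinals below \<open>r\<close> are the
  elements of \<open>Field r\<close>, and \<open>\<alpha> \<in> Field r\<close>, viewed as a set of ordinals, is \<open>underS r \<alpha>\<close>.
  Cardinals are the well-orders satisfying \<open>Card_order\<close>, i.e. initial ordinals.
\<close>

text \<open>
  Below, \<open>\<alpha> < \<beta>\<close> is strict, so only a limit ordinal \<open>\<delta>\<close> can satisfy the premise;
  \<open>0\<close> is excluded by the nonemptiness of \<open>underS r \<delta>\<close>.
\<close>
definition closed_in_ord :: "'o rel \<Rightarrow> 'o set \<Rightarrow> bool" where
  "closed_in_ord r C \<longleftrightarrow>
     (\<forall>\<delta>\<in>Field r. underS r \<delta> \<noteq> {} \<and>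
        (\<forall>\<alpha>\<in>underS r \<delta>. \<exists>\<beta>\<in>C \<inter> underS r \<delta>. \<alpha> \<noteq> \<beta> \<and> (\<alpha>, \<beta>) \<in> r) \<longrightarrow> \<delta> \<in> C)"

definition club :: "'o rel \<Rightarrow> 'o set \<Rightarrow> bool" where
  "club r C \<longleftrightarrow> C \<subseteq> Field r \<and> closed_in_ord r C \<and> cofinal C r"

definition stationary :: "'o rel \<Rightarrow> 'o set \<Rightarrow> bool" where
  "stationary r S \<longleftrightarrow> S \<subseteq> Field r \<and> (\<forall>C. club r C \<longrightarrow> S \<inter> C \<noteq> {})"

text \<open>
  An element of \<open>2\<^sup>\<alpha>\<close> is a partial function with domain \<open>underS r \<alpha>\<close>, so that sequences of different
  lengths are different objects and \<open>F\<close> may depend on the length. Values of \<open>F\<close> at partial functions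
  with other domains, and of \<open>f\<close> and \<open>g\<close> outside \<open>Field r\<close>, are irrelevant.
\<close>
definition weak_diamond :: "'o rel \<Rightarrow> bool" where
  "weak_diamond r \<longleftrightarrow>
     (\<forall>F :: ('o \<rightharpoonup> bool) \<Rightarrow> bool. \<exists>g :: 'o \<Rightarrow> bool. \<forall>f :: 'o \<Rightarrow> bool.
        stationary r {\<alpha> \<in> Field r. F ((Some \<circ> f) |` underS r \<alpha>) = g \<alpha>})"

end

theory Submission
  imports Defs
begin

text \<open>
  The weak diamond enters only through its cardinal arithmetic: it implies
  \<open>2\<^sup>\<kappa> < 2\<^bsup>\<kappa>\<^sup>+\<^esup>\<close> (\<open>weak_diamond_Pow_less_cardSuc\<close>). If subsets of \<open>\<kappa>\<close> could code subsets of
  \<open>\<kappa>\<^sup>+\<close>, then \<open>f\<close> restricted to \<open>\<kappa>\<close> could encode the negation of any given \<open>g\<close>, and an \<open>F\<close> that decodes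
  it would disagree with \<open>g\<close> at every \<open>\<alpha> \<ge> \<kappa>\<close>.

  Therefore \<open>\<lambda> = (2\<^sup>\<kappa>)\<^sup>+\<close> is at most \<open>2\<^bsup>\<kappa>\<^sup>+\<^esup>\<close>, and for this \<open>\<lambda>\<close> the conclusion is
  Galvin's theorem (\<open>galvin_club_subfamily\<close>). A club has at most \<open>2\<^sup>\<kappa>\<close> possible traces
  on each \<open>\<epsilon> < \<kappa>\<^sup>+\<close>, so by counting some member \<open>C \<alpha>\<close> of the family has, for every \<open>\<epsilon>\<close>, more than
  \<open>2\<^sup>\<kappa>\<close> other members agreeing with it up to \<open>\<epsilon>\<close>. Pick distinct indices \<open>\<beta> \<epsilon>\<close>, where \<open>C (\<beta> \<epsilon>)\<close>
  agrees with \<open>C \<alpha>\<close> up to \<open>\<epsilon>\<close>. On \<open>C \<alpha>\<close> the conditions \<open>\<delta> \<in> C (\<beta> \<epsilon>)\<close> with \<open>\<epsilon> \<ge> \<delta>\<close> then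
  hold automatically, so that the diagonal intersection, which imposes only those with \<open>\<epsilon> < \<delta>\<close>, lies
  in \<open>\<Inter>\<^sub>\<epsilon> C (\<beta> \<epsilon>)\<close> as far as it is inside \<open>C \<alpha>\<close>; and this part is a club because \<open>\<kappa>\<^sup>+\<close> is regular and uncountable.
\<close>

section \<open>Order and boundedness in cardinals\<close>

lemma card_order_linear:
  assumes "Card_order r"
  shows "Well_order r" "Linear_order r" "trans r" "antisym r" "Refl r"
proof -
  show "Well_order r"
    using assms by (rule card_order_on_well_order_on)
  then show "Linear_order r" "trans r" "antisym r" "Refl r"
    by (auto simp: order_on_defs well_order_on_def)
qed

lemma underS_trans:
  assumes "Card_order r" "x \<in> underS r y" "y \<in> underS r z"
  shows "x \<in> underS r z"
  using assms(2,3) card_order_linear(3,4)[OF assms(1)]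
  by (auto simp: underS_def dest: transD antisymD)

lemma underS_linear:
  assumes "Card_order r" "x \<in> Field r" "y \<in> Field r"
  shows "x \<in> underS r y \<or> x = y \<or> y \<in> underS r x"
  using card_order_linear(2)[OF assms(1)] assms(2,3)
  by (auto simp: underS_def linear_order_on_def total_on_def)

lemma cofinal_underS: "cofinal A r \<longleftrightarrow> (\<forall>x\<in>Field r. \<exists>y\<in>A. x \<in> underS r y)"
  by (auto simp: cofinal_def underS_def)

lemma closed_in_ord_underS:
  "closed_in_ord r C \<longleftrightarrow> (\<forall>\<delta>\<in>Field r. underS r \<delta> \<noteq> {} \<and>
     (\<forall>\<alpha>\<in>underS r \<delta>. \<exists>\<beta>\<in>C \<inter> underS r \<delta>. \<alpha> \<in> underS r \<beta>) \<longrightarrow> \<delta> \<in> C)"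
  by (simp add: closed_in_ord_def underS_def)

lemma ordLeq_Pow_mono:
  assumes "|A| \<le>o |B|"
  shows "|Pow A| \<le>o |Pow B|"
proof -
  obtain f where "inj_on f A" "f ` A \<subseteq> B"
    using assms card_of_ordLeq[of A B] by blast
  then have "inj_on ((`) f) (Pow A)" "(`) f ` Pow A \<subseteq> Pow B"
    by (auto simp: inj_on_image_Pow)
  then show ?thesis
    using card_of_ordLeq[of "Pow A" "Pow B"] by blast
qed

lemma regularCard_bounded:
  assumes r: "Card_order r" "regularCard r" and inf: "infinite (Field r)"
    and A: "A \<subseteq> Field r" "|A| <o r"
  shows "\<exists>b\<in>Field r. A \<subseteq> underS r b"
proof -
  have "\<not> cofinal A r"
    using r A not_ordLess_ordIso unfolding regularCard_def by blast
  then obtain a where a: "a \<in> Field r" "\<forall>y\<in>A. a \<notin> underS r y"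
    by (auto simp: cofinal_underS)
  obtain b where b: "b \<in> Field r" "a \<in> underS r b"
    using infinite_Card_order_limit[OF r(1) inf a(1)] by (auto simp: underS_def)
  have "y \<in> underS r b" if "y \<in> A" for y
    using underS_linear[OF r(1), of y a] underS_trans[OF r(1) _ b(2), of y] a b A(1) that by blast
  then show ?thesis
    using b by blast
qed

lemma card_of_under:
  assumes r: "Card_order r" "infinite (Field r)" and \<epsilon>: "\<epsilon> \<in> Field r"
  shows "|under r \<epsilon>| <o r"
proof -
  obtain b where b: "b \<in> Field r" "\<epsilon> \<in> underS r b"
    using infinite_Card_order_limit[OF r \<epsilon>] by (auto simp: underS_def)
  have "x \<in> underS r b" if "x \<in> under r \<epsilon>" for x
    using that b(2) underS_trans[OF r(1) _ b(2), of x]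
    by (cases "x = \<epsilon>") (simp_all add: under_def underS_def)
  then have "|under r \<epsilon>| \<le>o |underS r b|"
    by (intro card_of_mono1 subsetI)
  then show ?thesis
    using card_of_underS[OF r(1) b(1)] by (rule ordLeq_ordLess_trans)
qed

section \<open>Diagonal intersections of closed unbounded sets\<close>

text \<open>
  Here \<open>\<delta>\<close> is the supremum of the chain, which exists because a countable set is bounded in a regular
  uncountable cardinal.
\<close>
lemma strict_chain_supremum:
  assumes r: "Card_order r" "regularCard r" and unc: "natLeq <o r"
    and s: "\<And>n. s n \<in> underS r (s (Suc n))"
  shows "\<exists>\<delta>\<in>Field r. range s \<subseteq> underS r \<delta> \<and> (\<forall>x\<in>underS r \<delta>. \<exists>n. x \<in> underS r (s n))"
proof -
  have inf: "infinite (Field r)"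
    using cinfinite_mono[OF ordLess_imp_ordLeq[OF unc] natLeq_cinfinite] by (simp add: cinfinite_def)
  have sub: "range s \<subseteq> Field r"
    using s underS_Field by fast
  have "|range s| \<le>o |UNIV :: nat set|"
    by (rule card_of_image)
  then have "|range s| <o r"
    using card_of_nat unc ordLeq_ordIso_trans ordLeq_ordLess_trans by blast
  then obtain b where b: "b \<in> {y \<in> Field r. range s \<subseteq> underS r y}"
    using regularCard_bounded[OF r inf sub] by blast
  have "wf (r - Id)"
    using card_order_linear(1)[OF r(1)] by (simp add: well_order_on_def)
  from wfE_min[OF this b] obtain \<delta> where d: "\<delta> \<in> {y \<in> Field r. range s \<subseteq> underS r y}"
    and least: "\<And>y. (y, \<delta>) \<in> r - Id \<Longrightarrow> y \<notin> {y \<in> Field r. range s \<subseteq> underS r y}"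
    by metis
  have "\<exists>n. x \<in> underS r (s n)" if x: "x \<in> underS r \<delta>" for x
  proof (rule ccontr)
    assume none: "\<nexists>n. x \<in> underS r (s n)"
    have xF: "x \<in> Field r"
      using x underS_Field by fast
    have "s n \<in> underS r x" for n
    proof -
      have "s n \<noteq> x"
        using s[of n] none by blast
      then show ?thesis
        using none underS_linear[OF r(1) xF, of "s n"] sub by blast
    qed
    then show False
      using least[of x] x xF by (auto simp: underS_def)
  qed
  then show ?thesis
    using d by blast
qed

text \<open>
  For unboundedness, iterate \<open>\<omega>\<close> times a function \<open>nx\<close> such that \<open>B\<close> and each \<open>C \<epsilon>\<close> with \<open>\<epsilon> < x\<close> have
  a point between \<open>x\<close> and \<open>nx x\<close>; regularity provides \<open>nx\<close>. If \<open>\<delta>\<close> is the supremum of the iterates,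
  then \<open>B\<close> and each \<open>C \<epsilon>\<close> with \<open>\<epsilon> < \<delta>\<close> are unbounded in \<open>\<delta>\<close>, hence contain it. Building \<open>B\<close> into
  the statement covers the intersection with one further club, which Galvin's argument needs.
\<close>
lemma club_diagonal_intersection:
  assumes r: "Card_order r" "regularCard r" and unc: "natLeq <o r"
    and B: "club r B" and C: "\<And>\<epsilon>. \<epsilon> \<in> Field r \<Longrightarrow> club r (C \<epsilon>)"
  shows "club r {\<delta> \<in> B. \<forall>\<epsilon>\<in>underS r \<delta>. \<delta> \<in> C \<epsilon>}" (is "club r ?D")
proof -
  have inf: "infinite (Field r)"
    using cinfinite_mono[OF ordLess_imp_ordLeq[OF unc] natLeq_cinfinite] by (simp add: cinfinite_def)
  have trans: "\<And>x y z. x \<in> underS r y \<Longrightarrow> y \<in> underS r z \<Longrightarrow> x \<in> underS r z"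
    using underS_trans[OF r(1)] .
  have F: "\<And>x y. x \<in> underS r y \<Longrightarrow> x \<in> Field r" "\<And>x y. x \<in> underS r y \<Longrightarrow> y \<in> Field r"
    by (auto simp: underS_def Field_def)
  note cofinal = club_def cofinal_underS
  have "closed_in_ord r ?D"
    unfolding closed_in_ord_underS
  proof (intro ballI impI, elim conjE)
    fix \<delta> assume d: "\<delta> \<in> Field r" "underS r \<delta> \<noteq> {}"
      and lim: "\<forall>\<alpha>\<in>underS r \<delta>. \<exists>\<beta>\<in>?D \<inter> underS r \<delta>. \<alpha> \<in> underS r \<beta>"
    have "\<delta> \<in> B"
      using B d lim unfolding club_def closed_in_ord_underS by blast
    moreover have "\<delta> \<in> C \<epsilon>" if e: "\<epsilon> \<in> underS r \<delta>" for \<epsilon>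
    proof -
      have "\<exists>\<beta>\<in>C \<epsilon> \<inter> underS r \<delta>. \<alpha> \<in> underS r \<beta>" if a: "\<alpha> \<in> underS r \<delta>" for \<alpha>
      proof -
        \<comment> \<open>A point of the diagonal intersection lies in \<open>C \<epsilon>\<close> only when it is above \<open>\<epsilon>\<close>, so the
          point is taken above \<open>\<alpha>\<close> and \<open>\<epsilon>\<close> at once.\<close>
        obtain \<alpha>' where "\<alpha>' \<in> underS r \<delta>" "\<alpha> = \<alpha>' \<or> \<alpha> \<in> underS r \<alpha>'" "\<epsilon> = \<alpha>' \<or> \<epsilon> \<in> underS r \<alpha>'"
          using underS_linear[OF r(1), of \<alpha> \<epsilon>] a e F by blast
        then obtain \<beta> where "\<beta> \<in> ?D \<inter> underS r \<delta>" "\<alpha> \<in> underS r \<beta>" "\<epsilon> \<in> underS r \<beta>"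
          using lim trans by blast
        then show ?thesis by blast
      qed
      then show ?thesis
        using C[OF F(1)[OF e]] d unfolding club_def closed_in_ord_underS by blast
    qed
    ultimately show "\<delta> \<in> ?D" by blast
  qed
  moreover have "\<exists>\<delta>\<in>?D. \<gamma> \<in> underS r \<delta>" if g: "\<gamma> \<in> Field r" for \<gamma>
  proof -
    have "\<exists>b\<in>Field r. x \<in> underS r b \<and> (\<exists>p\<in>B \<inter> underS r b. x \<in> underS r p) \<and>
            (\<forall>\<epsilon>\<in>underS r x. \<exists>p\<in>C \<epsilon> \<inter> underS r b. x \<in> underS r p)" if x: "x \<in> Field r" for x
    proof -
      obtain p where p: "p \<in> B" "x \<in> underS r p"
        using B x unfolding cofinal by blast
      have "\<forall>\<epsilon>\<in>underS r x. \<exists>q\<in>C \<epsilon>. x \<in> underS r q"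
        using C F(1) x unfolding cofinal by blast
      then obtain q where q: "\<And>\<epsilon>. \<epsilon> \<in> underS r x \<Longrightarrow> q \<epsilon> \<in> C \<epsilon> \<and> x \<in> underS r (q \<epsilon>)"
        by metis
      let ?A = "{p} \<union> q ` underS r x"
      have "|{p}| <o r"
        using finite_ordLess_infinite[OF card_of_Well_order card_order_linear(1)[OF r(1)], of "{p}"] inf
        by (simp add: Field_card_of)
      moreover have "|q ` underS r x| <o r"
        using card_of_image card_of_underS[OF r(1) x] ordLeq_ordLess_trans by blast
      ultimately have "|?A| <o r"
        using card_of_Un_ordLess_infinite_Field[OF inf r(1)] by blast
      moreover have "?A \<subseteq> Field r"
        using p q F by blast
      ultimately obtain b where "b \<in> Field r" "?A \<subseteq> underS r b"
        using regularCard_bounded[OF r inf] by blast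
      then show ?thesis
        using p q trans by blast
    qed
    then obtain nx where nx: "\<And>x. x \<in> Field r \<Longrightarrow> nx x \<in> Field r \<and> x \<in> underS r (nx x) \<and>
        (\<exists>p\<in>B \<inter> underS r (nx x). x \<in> underS r p) \<and>
        (\<forall>\<epsilon>\<in>underS r x. \<exists>p\<in>C \<epsilon> \<inter> underS r (nx x). x \<in> underS r p)"
      by metis
    define s where "s n = (nx ^^ n) \<gamma>" for n
    have sF: "s n \<in> Field r" for n
      by (induction n) (use g nx in \<open>auto simp: s_def\<close>)
    have s_Suc: "s (Suc n) = nx (s n)" for n
      by (simp add: s_def)
    have mono: "s m \<in> underS r (s n)" if "m < n" for m n
      using that by (induction rule: strict_inc_induct) (use nx sF s_Suc trans in metis)+
    obtain \<delta> where d: "\<delta> \<in> Field r" "range s \<subseteq> underS r \<delta>"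
      and sup: "\<And>x. x \<in> underS r \<delta> \<Longrightarrow> \<exists>n. x \<in> underS r (s n)"
      using strict_chain_supremum[OF r unc, of s, OF mono[OF lessI]] by blast
    have ne: "underS r \<delta> \<noteq> {}"
      using d by blast
    have "\<exists>\<beta>\<in>B \<inter> underS r \<delta>. \<alpha> \<in> underS r \<beta>" if a: "\<alpha> \<in> underS r \<delta>" for \<alpha>
    proof -
      obtain n where "\<alpha> \<in> underS r (s n)"
        using sup a by blast
      moreover obtain p where "p \<in> B" "s n \<in> underS r p" "p \<in> underS r (s (Suc n))"
        using nx[OF sF[of n]] unfolding s_Suc by blast
      ultimately show ?thesis
        using trans d(2) by blast
    qed
    then have "\<delta> \<in> B"
      using B d ne unfolding club_def closed_in_ord_underS by blast
    moreover have "\<delta> \<in> C \<epsilon>" if e: "\<epsilon> \<in> underS r \<delta>" for \<epsilon>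
    proof -
      have "\<exists>\<beta>\<in>C \<epsilon> \<inter> underS r \<delta>. \<alpha> \<in> underS r \<beta>" if a: "\<alpha> \<in> underS r \<delta>" for \<alpha>
      proof -
        obtain m n where mn: "\<alpha> \<in> underS r (s m)" "\<epsilon> \<in> underS r (s n)"
          using sup a e by blast
        define k where "k = max m n"
        have k: "\<alpha> \<in> underS r (s k)" "\<epsilon> \<in> underS r (s k)"
          using mn mono[of m n] mono[of n m] trans by (auto simp: k_def max_def not_le order_le_less)
        moreover obtain p where "p \<in> C \<epsilon>" "s k \<in> underS r p" "p \<in> underS r (s (Suc k))"
          using nx[OF sF[of k]] k unfolding s_Suc by blast
        ultimately show ?thesis
          using trans d(2) by blast
      qed
      then show ?thesis
        using C[OF F(1)[OF e]] d ne unfolding club_def closed_in_ord_underS by blast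
    qed
    ultimately show ?thesis
      using d(2) s_def[of 0] by (intro bexI[of _ \<delta>]) auto
  qed
  ultimately show ?thesis
    using B unfolding club_def cofinal_underS by blast
qed

section \<open>The weak diamond and cardinal exponentiation\<close>

lemma tail_club:
  assumes r: "Card_order r" "infinite (Field r)" and a: "a \<in> Field r"
  shows "club r {x \<in> Field r. (a, x) \<in> r}" (is "club r ?T")
proof -
  have T: "x \<in> ?T \<longleftrightarrow> x = a \<or> a \<in> underS r x" for x
    using a refl_onD[OF card_order_linear(5)[OF r(1)]] by (auto simp: underS_def intro: FieldI2)
  have "\<exists>y\<in>?T. x \<in> underS r y" if "x \<in> Field r" for x
  proof -
    obtain m where m: "m \<in> Field r" "a = m \<or> a \<in> underS r m" "x = m \<or> x \<in> underS r m"
      using underS_linear[OF r(1), of a x] a \<open>x \<in> Field r\<close> by blast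
    obtain b where b: "m \<in> underS r b"
      using infinite_Card_order_limit[OF r m(1)] by (auto simp: underS_def)
    then have "a \<in> underS r b" "x \<in> underS r b"
      using m(2,3) underS_trans[OF r(1) _ b] by auto
    then show ?thesis
      using T by blast
  qed
  moreover have "closed_in_ord r ?T"
    unfolding closed_in_ord_underS
  proof (intro ballI impI, elim conjE)
    fix \<delta> assume "underS r \<delta> \<noteq> {}"
      and "\<forall>\<alpha>\<in>underS r \<delta>. \<exists>\<beta>\<in>?T \<inter> underS r \<delta>. \<alpha> \<in> underS r \<beta>"
    then obtain \<beta> where "\<beta> \<in> ?T" "\<beta> \<in> underS r \<delta>"
      by blast
    then have "a \<in> underS r \<delta>"
      using T[of \<beta>] underS_trans[OF r(1), of a \<beta> \<delta>] by blast
    then show "\<delta> \<in> ?T"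
      using T by blast
  qed
  ultimately show ?thesis
    by (auto simp: club_def cofinal_underS)
qed

text \<open>
  If subsets of \<open>underS r a\<close> could code all subsets of \<open>Field r\<close>, then a sequence could announce in its
  first \<open>a\<close> entries a whole prediction to defeat. The function \<open>F\<close> below decodes the announcement from any
  longer initial segment and reads it off at the length of that segment. For any \<open>g\<close>, a sequence
  announcing the complement of \<open>g\<close> makes \<open>F\<close> differ from \<open>g\<close> at every length from \<open>a\<close> on, so that
  the places where they agree miss a club.
\<close>
lemma weak_diamond_Pow_underS_less:
  assumes wd: "weak_diamond r" and r: "Card_order r" "infinite (Field r)" and a: "a \<in> Field r"
  shows "|Pow (underS r a)| <o |Pow (Field r)|"
proof (rule ccontr)
  assume "\<not> ?thesis"
  then have "|Pow (Field r)| \<le>o |Pow (underS r a)|"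
    using card_of_Well_order not_ordLess_iff_ordLeq by blast
  then obtain h where h: "h ` Pow (underS r a) = Pow (Field r)"
    using card_of_ordLeq2[of "Pow (Field r)" "Pow (underS r a)"] by blast
  define len where "len p = (THE \<alpha>. \<alpha> \<in> Field r \<and> dom p = underS r \<alpha>)" for p :: "'a \<rightharpoonup> bool"
  define F where "F p \<longleftrightarrow> len p \<in> h {y \<in> underS r a. p y = Some True}" for p
  have len: "len p = \<alpha>" if "\<alpha> \<in> Field r" "dom p = underS r \<alpha>" for p \<alpha>
    unfolding len_def
  proof (rule the_equality)
    fix \<beta> assume "\<beta> \<in> Field r \<and> dom p = underS r \<beta>"
    then show "\<beta> = \<alpha>"
      using that underS_linear[OF r(1), of \<alpha> \<beta>] underS_notIn[of \<alpha> r] underS_notIn[of \<beta> r] by auto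
  qed (use that in simp)
  obtain g where g: "\<And>f. stationary r {\<alpha> \<in> Field r. F ((Some \<circ> f) |` underS r \<alpha>) = g \<alpha>}"
    using wd unfolding weak_diamond_def by meson
  have "{x \<in> Field r. \<not> g x} \<in> h ` Pow (underS r a)"
    unfolding h by blast
  then obtain A where A: "A \<subseteq> underS r a" "h A = {x \<in> Field r. \<not> g x}"
    by auto
  define f where "f y \<longleftrightarrow> y \<in> A" for y
  have "F ((Some \<circ> f) |` underS r \<alpha>) \<noteq> g \<alpha>" if \<alpha>: "\<alpha> \<in> Field r" "(a, \<alpha>) \<in> r" for \<alpha>
  proof -
    have "underS r a \<subseteq> underS r \<alpha>"
      using underS_incr card_order_linear(3,4)[OF r(1)] \<alpha>(2) by metis
    then have "{y \<in> underS r a. ((Some \<circ> f) |` underS r \<alpha>) y = Some True} = A"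
      using A(1) by (auto simp: f_def restrict_map_def)
    moreover have "len ((Some \<circ> f) |` underS r \<alpha>) = \<alpha>"
      by (rule len) (auto simp: \<alpha> restrict_map_def dom_def)
    ultimately show ?thesis
      using A(2) \<alpha>(1) by (simp add: F_def)
  qed
  then show False
    using g[of f] tail_club[OF r a] unfolding stationary_def by blast
qed

lemma weak_diamond_Pow_less_cardSuc:
  assumes "Cinfinite \<kappa>" "weak_diamond (cardSuc \<kappa>)"
  shows "|Pow (Field \<kappa>)| <o |Pow (Field (cardSuc \<kappa>))|"
proof -
  let ?r = "cardSuc \<kappa>"
  have \<kappa>: "Card_order \<kappa>"
    using assms(1) by simp
  have r: "Card_order ?r" "infinite (Field ?r)" "\<kappa> <o ?r"
    using \<kappa> cardSuc_greater Cinfinite_cardSuc[OF assms(1)] by (auto simp: cinfinite_def)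
  obtain a where a: "a \<in> Field ?r" and iso: "\<kappa> =o Restr ?r (underS ?r a)"
    using r(3) ordLess_iff_ordIso_Restr[OF card_order_linear(1)[OF r(1)] card_order_linear(1)[OF \<kappa>]]
    by blast
  have "Field (Restr ?r (underS ?r a)) \<subseteq> underS ?r a"
    by (auto simp: Field_def)
  then have "|Field \<kappa>| \<le>o |underS ?r a|"
    using card_of_mono2[OF ordIso_imp_ordLeq[OF iso]] card_of_mono1 ordLeq_transitive by blast
  then have "|Pow (Field \<kappa>)| \<le>o |Pow (underS ?r a)|"
    by (rule ordLeq_Pow_mono)
  also have "|Pow (underS ?r a)| <o |Pow (Field ?r)|"
    using weak_diamond_Pow_underS_less[OF assms(2) r(1,2) a] .
  finally show ?thesis .
qed

section \<open>Galvin's theorem on families of closed unbounded sets\<close>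

text \<open>
  Otherwise every \<open>\<alpha>\<close> belongs, for some \<open>\<epsilon>\<close>, to a class of size at most \<open>\<theta>\<close> of the relation
  ``same trace up to \<open>\<epsilon>\<close>''. There are at most \<open>\<theta>\<close> values of \<open>\<epsilon>\<close> and, for each of them, at most
  \<open>\<theta>\<close> traces, so these small classes cover at most \<open>\<theta>\<close> indices in all.
\<close>
lemma index_agreeing_with_many:
  assumes r: "r \<le>o \<theta>" "Card_order r" and \<theta>: "Cinfinite \<theta>"
    and P: "\<And>\<epsilon>. \<epsilon> \<in> Field r \<Longrightarrow> |Pow (under r \<epsilon>)| \<le>o \<theta>"
    and A: "\<not> |A| \<le>o \<theta>"
  shows "\<exists>\<alpha>\<in>A. \<forall>\<epsilon>\<in>Field r. \<not> |{\<beta> \<in> A. C \<beta> \<inter> under r \<epsilon> = C \<alpha> \<inter> under r \<epsilon>}| \<le>o \<theta>"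
proof (rule ccontr)
  have \<theta>': "Card_order \<theta>" "infinite (Field \<theta>)"
    using \<theta> by (auto simp: cinfinite_def)
  define H where "H \<epsilon> Y = {\<beta> \<in> A. C \<beta> \<inter> under r \<epsilon> = Y}" for \<epsilon> Y
  assume "\<not> ?thesis"
  then have "\<forall>\<alpha>\<in>A. \<exists>\<epsilon>\<in>Field r. |H \<epsilon> (C \<alpha> \<inter> under r \<epsilon>)| \<le>o \<theta>"
    by (simp add: H_def)
  then have "A \<subseteq> (\<Union>\<epsilon>\<in>Field r. \<Union>Y\<in>{Y \<in> Pow (under r \<epsilon>). |H \<epsilon> Y| \<le>o \<theta>}. H \<epsilon> Y)"
    by (fastforce simp: H_def)
  then have "|A| \<le>o |\<Union>\<epsilon>\<in>Field r. \<Union>Y\<in>{Y \<in> Pow (under r \<epsilon>). |H \<epsilon> Y| \<le>o \<theta>}. H \<epsilon> Y|"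
    by (rule card_of_mono1)
  also have "|\<Union>\<epsilon>\<in>Field r. \<Union>Y\<in>{Y \<in> Pow (under r \<epsilon>). |H \<epsilon> Y| \<le>o \<theta>}. H \<epsilon> Y| \<le>o \<theta>"
  proof (rule card_of_UNION_ordLeq_infinite_Field[OF \<theta>'(2,1)])
    show "|Field r| \<le>o \<theta>"
      using r card_of_Field_ordIso ordIso_ordLeq_trans by blast
    show "\<forall>\<epsilon>\<in>Field r. |\<Union>Y\<in>{Y \<in> Pow (under r \<epsilon>). |H \<epsilon> Y| \<le>o \<theta>}. H \<epsilon> Y| \<le>o \<theta>"
    proof
      fix \<epsilon> assume "\<epsilon> \<in> Field r"
      then have "|{Y \<in> Pow (under r \<epsilon>). |H \<epsilon> Y| \<le>o \<theta>}| \<le>o \<theta>"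
        using P card_of_mono1[of "{Y \<in> Pow (under r \<epsilon>). |H \<epsilon> Y| \<le>o \<theta>}" "Pow (under r \<epsilon>)"]
          ordLeq_transitive by blast
      then show "|\<Union>Y\<in>{Y \<in> Pow (under r \<epsilon>). |H \<epsilon> Y| \<le>o \<theta>}. H \<epsilon> Y| \<le>o \<theta>"
        by (intro card_of_UNION_ordLeq_infinite_Field[OF \<theta>'(2,1)]) auto
    qed
  qed
  finally show False
    using A by blast
qed

text \<open>The recursion never gets stuck: before step \<open>\<epsilon>\<close> fewer than \<open>|r|\<close> values are used up,
  and \<open>H \<epsilon>\<close> is too large to be exhausted by them.\<close>
lemma injective_choice:
  assumes r: "Card_order r" and H: "\<And>\<epsilon>. \<epsilon> \<in> Field r \<Longrightarrow> \<not> |H \<epsilon>| <o r"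
  shows "\<exists>\<beta>. inj_on \<beta> (Field r) \<and> (\<forall>\<epsilon>\<in>Field r. \<beta> \<epsilon> \<in> H \<epsilon>)"
proof -
  define P where "P \<beta> \<epsilon> x \<longleftrightarrow> (\<epsilon> \<in> Field r \<longrightarrow> x \<in> H \<epsilon> \<and> x \<notin> \<beta> ` underS r \<epsilon>)" for \<beta> \<epsilon> x
  have "\<exists>\<beta>. \<forall>\<epsilon>. P \<beta> \<epsilon> (\<beta> \<epsilon>)"
  proof (rule dependent_wf_choice)
    show "wf (r - Id)"
      using card_order_linear(1)[OF r] by (simp add: well_order_on_def)
    show "P f \<epsilon> x = P g \<epsilon> x" if "\<And>z. (z, \<epsilon>) \<in> r - Id \<Longrightarrow> f z = g z" for f g \<epsilon> x
    proof -
      have "f ` underS r \<epsilon> = g ` underS r \<epsilon>"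
        using that by (intro image_cong) (auto simp: underS_def)
      then show ?thesis by (simp add: P_def)
    qed
    show "\<exists>x. P f \<epsilon> x" for \<epsilon> f
    proof (cases "\<epsilon> \<in> Field r")
      case True
      have "|f ` underS r \<epsilon>| <o r"
        using card_of_image card_of_underS[OF r True] ordLeq_ordLess_trans by blast
      then have "\<not> H \<epsilon> \<subseteq> f ` underS r \<epsilon>"
        using H[OF True] card_of_mono1 ordLeq_ordLess_trans by blast
      then show ?thesis by (auto simp: P_def)
    qed (simp add: P_def)
  qed
  then obtain \<beta> where \<beta>: "\<And>\<epsilon>. \<epsilon> \<in> Field r \<Longrightarrow> \<beta> \<epsilon> \<in> H \<epsilon> \<and> \<beta> \<epsilon> \<notin> \<beta> ` underS r \<epsilon>"
    unfolding P_def by blast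
  have "inj_on \<beta> (Field r)"
    using \<beta> underS_linear[OF r] by (intro inj_onI) (metis imageI)
  then show ?thesis
    using \<beta> by blast
qed

text \<open>
  Fix \<open>\<alpha>\<close> from \<open>index_agreeing_with_many\<close> and choose distinct \<open>\<beta> \<epsilon>\<close> such that \<open>C (\<beta> \<epsilon>)\<close> agrees with
  \<open>C \<alpha>\<close> up to and including \<open>\<epsilon>\<close>. For \<open>\<delta>\<close> in \<open>C \<alpha>\<close> and in the diagonal intersection of the
  \<open>C (\<beta> \<epsilon>)\<close>, membership in \<open>C (\<beta> \<epsilon>)\<close> holds by diagonality if \<open>\<epsilon> < \<delta>\<close>, and by the agreement if
  \<open>\<delta> \<le> \<epsilon>\<close>. The part of the diagonal intersection inside \<open>C \<alpha>\<close> is thus contained in the full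
  intersection.
\<close>
theorem galvin_club_subfamily:
  assumes r: "Card_order r" "regularCard r" and unc: "natLeq <o r"
    and \<theta>: "Card_order \<theta>" "r \<le>o \<theta>" "\<And>\<epsilon>. \<epsilon> \<in> Field r \<Longrightarrow> |Pow (under r \<epsilon>)| \<le>o \<theta>"
    and A: "\<theta> <o |A|" and C: "\<And>\<alpha>. \<alpha> \<in> A \<Longrightarrow> club r (C \<alpha>)"
  shows "\<exists>I\<subseteq>A. |I| =o r \<and> (\<exists>D. club r D \<and> D \<subseteq> (\<Inter>i\<in>I. C i))"
proof -
  have "cinfinite \<theta>"
    using cinfinite_mono[OF ordLess_imp_ordLeq[OF unc] natLeq_cinfinite] \<theta>(2) cinfinite_mono by blast
  then obtain \<alpha> where \<alpha>: "\<alpha> \<in> A"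
    and big: "\<And>\<epsilon>. \<epsilon> \<in> Field r \<Longrightarrow> \<not> |{\<beta> \<in> A. C \<beta> \<inter> under r \<epsilon> = C \<alpha> \<inter> under r \<epsilon>}| \<le>o \<theta>"
    using index_agreeing_with_many[OF \<theta>(2) r(1) _ \<theta>(3), of A C] \<theta>(1) A not_ordLess_ordLeq by blast
  have "\<not> |{\<beta> \<in> A. C \<beta> \<inter> under r \<epsilon> = C \<alpha> \<inter> under r \<epsilon>}| <o r" if "\<epsilon> \<in> Field r" for \<epsilon>
    using big[OF that] \<theta>(2) ordLess_ordLeq_trans ordLess_imp_ordLeq by blast
  then obtain \<beta> where inj: "inj_on \<beta> (Field r)" and \<beta>A: "\<And>\<epsilon>. \<epsilon> \<in> Field r \<Longrightarrow> \<beta> \<epsilon> \<in> A"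
    and agree: "\<And>\<epsilon>. \<epsilon> \<in> Field r \<Longrightarrow> C (\<beta> \<epsilon>) \<inter> under r \<epsilon> = C \<alpha> \<inter> under r \<epsilon>"
    using injective_choice[OF r(1), of "\<lambda>\<epsilon>. {\<beta> \<in> A. C \<beta> \<inter> under r \<epsilon> = C \<alpha> \<inter> under r \<epsilon>}"]
    by blast
  define D where "D = {\<delta> \<in> C \<alpha>. \<forall>\<epsilon>\<in>underS r \<delta>. \<delta> \<in> C (\<beta> \<epsilon>)}"
  have "club r D"
    unfolding D_def using C[OF \<alpha>] C[OF \<beta>A] by (rule club_diagonal_intersection[OF r unc])
  moreover have "\<delta> \<in> C (\<beta> \<epsilon>)" if d: "\<delta> \<in> D" and e: "\<epsilon> \<in> Field r" for \<delta> \<epsilon>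
  proof (cases "\<epsilon> \<in> underS r \<delta>")
    case False
    have "\<delta> \<in> Field r"
      using d C[OF \<alpha>] by (auto simp: D_def club_def)
    then have "\<delta> \<in> under r \<epsilon>"
      using False underS_linear[OF r(1), of \<delta> \<epsilon>] e card_order_linear(5)[OF r(1)]
      by (auto simp: under_def underS_def refl_on_def)
    then show ?thesis
      using agree[OF e] d by (auto simp: D_def)
  qed (use d in \<open>simp add: D_def\<close>)
  moreover have "|\<beta> ` Field r| =o r"
    using card_of_ordIsoI[OF inj_on_imp_bij_betw[OF inj]] card_of_Field_ordIso[OF r(1)]
      ordIso_symmetric ordIso_transitive by blast
  ultimately show ?thesis
    using \<beta>A by (intro exI[of _ "\<beta> ` Field r"]) blast
qed

lemma ctwo_cexp_ordIso_Pow: "ctwo ^c r =o |Pow (Field r)|"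
  unfolding cexp_def ctwo_def Field_card_of
  by (rule ordIso_symmetric[OF card_of_Pow_Func])

theorem corollary2p2:
  fixes \<kappa> :: "'a rel"
  assumes "Cinfinite \<kappa>"
    and "weak_diamond (cardSuc \<kappa>)"
  shows "\<exists>\<mu> :: ('a set \<Rightarrow> bool) rel.
    Card_order \<mu> \<and> \<mu> \<le>o ctwo ^c cardSuc \<kappa> \<and>
    (\<forall>C :: ('a set \<Rightarrow> bool) \<Rightarrow> 'a set set.
      (\<forall>i\<in>Field \<mu>. club (cardSuc \<kappa>) (C i)) \<longrightarrow>
      (\<exists>I\<subseteq>Field \<mu>. |I| =o cardSuc \<kappa> \<and>
        (\<exists>D. club (cardSuc \<kappa>) D \<and> D \<subseteq> (\<Inter>i\<in>I. C i))))"
proof -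
  let ?r = "cardSuc \<kappa>"
  let ?\<theta> = "|Pow (Field \<kappa>)|"
  have \<kappa>: "Card_order \<kappa>" "infinite (Field \<kappa>)"
    using assms(1) by (auto simp: cinfinite_def)
  have r: "Card_order ?r" "regularCard ?r" "infinite (Field ?r)" "\<kappa> <o ?r"
    using \<kappa> assms(1) cardSuc_Card_order regularCard_cardSuc cardSuc_greater Cinfinite_cardSuc
    by (auto simp: cinfinite_def)
  have unc: "natLeq <o ?r"
    using natLeq_ordLeq_cinfinite[OF assms(1)] r(4) by (rule ordLeq_ordLess_trans)
  have "\<kappa> <o ?\<theta>"
    using Card_order_Pow[OF \<kappa>(1)] .
  then have r_le: "?r \<le>o ?\<theta>"
    using cardSuc_least[OF \<kappa>(1) card_of_Card_order] by blast
  have Pow_le: "|Pow (under ?r \<epsilon>)| \<le>o ?\<theta>" if e: "\<epsilon> \<in> Field ?r" for \<epsilon>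
  proof -
    have "|under ?r \<epsilon>| \<le>o \<kappa>"
      using card_of_under[OF r(1,3) e] unfolding cardSuc_ordLeq_ordLess[OF \<kappa>(1) card_of_Card_order] .
    then have "|under ?r \<epsilon>| \<le>o |Field \<kappa>|"
      using card_of_Field_ordIso[OF \<kappa>(1)] ordIso_symmetric ordLeq_ordIso_trans by blast
    then show ?thesis
      by (rule ordLeq_Pow_mono)
  qed
  have "?\<theta> <o |Pow (Field ?r)|"
    using weak_diamond_Pow_less_cardSuc[OF assms] .
  also have "|Pow (Field ?r)| =o ctwo ^c ?r"
    by (rule ordIso_symmetric[OF ctwo_cexp_ordIso_Pow])
  finally have "cardSuc ?\<theta> \<le>o ctwo ^c ?r"
    using cardSuc_least[OF card_of_Card_order Card_order_cexp] by blast
  moreover have Suc_\<theta>: "|Field (cardSuc ?\<theta>)| =o cardSuc ?\<theta>"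
    by (rule card_of_Field_ordIso[OF cardSuc_Card_order[OF card_of_Card_order]])
  ultimately have "|Field (cardSuc ?\<theta>)| \<le>o ctwo ^c ?r"
    by (metis ordIso_ordLeq_trans)
  \<comment> \<open>The successor of \<open>2\<^sup>\<kappa>\<close> lives on another type; a set of the same size in the required
    type is found inside the field of \<open>ctwo ^c cardSuc \<kappa>\<close>.\<close>
  from iffD1[OF internalize_card_of_ordLeq this] obtain A :: "('a set \<Rightarrow> bool) set"
    where A: "|Field (cardSuc ?\<theta>)| =o |A|" "|A| \<le>o ctwo ^c ?r"
    by (elim exE conjE)
  have "?\<theta> <o |A|"
    using cardSuc_greater[OF card_of_Card_order] ordIso_transitive[OF ordIso_symmetric[OF Suc_\<theta>] A(1)]
    by (rule ordLess_ordIso_trans)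
  note galvin = galvin_club_subfamily[OF r(1,2) unc card_of_Card_order r_le Pow_le this]
  show ?thesis
  proof (intro exI[of _ "|A|"] conjI allI impI)
    fix C :: "('a set \<Rightarrow> bool) \<Rightarrow> 'a set set"
    assume "\<forall>i\<in>Field |A|. club ?r (C i)"
    then have "\<And>i. i \<in> A \<Longrightarrow> club ?r (C i)"
      by (simp only: Field_card_of Ball_def)
    from galvin[OF _ this] show "\<exists>I\<subseteq>Field |A|. |I| =o ?r \<and> (\<exists>D. club ?r D \<and> D \<subseteq> (\<Inter>i\<in>I. C i))"
      by (simp only: Field_card_of)
  qed (rule card_of_Card_order A(2))+
qed

end
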